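(* Let $G$ be a non-cyclic finite group. Let $\Delta(G)$ be the hypergraph whose vertices are the elements of $G$ and whose hyperedges are the minimal generating sets of $G$. Then the set of isolated vertices of $\Delta(G)$ coincides with the Frattini subgroup $\mathrm{Frat}(G)$ of $G$, and the hypergraph $\tilde\Delta(G)$ obtained from $\Delta(G)$ by removing its isolated vertices is connected.
   Context: A hypergraph is a pair $(V,E)$ with $E$ a set of subsets of $V$ (the hyperedges). A generating set of $G$ is minimal if no proper subset of it generates $G$ (minimality is with respect to inclusion, not cardinality). A vertex is isolated if it lies in no hyperedge. A path between two distinct vertices $x_1$ and $x_k$ is a sequence $x_1,e_1,\dots,x_{k-1},e_{k-1},x_k$ with $x_1,\dots,x_k$ distinct vertices, $e_1,\dots,e_{k-1}$ hyperedges (not necessarily distinct) and $x_j,x_{j+1}\in e_j$ for $1\le j\le k-1$. A hypergraph is connected if any two distinct vertices are joined by a path. The Frattini subgroup is the intersection of all maximal subgroups of $G$. *)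

theory Defs
  imports "HOL-Algebra.Elementary_Groups"
begin

type_synonym 'a hypergraph = "'a set \<times> 'a set set"

definition isolated_vertices :: "'a hypergraph \<Rightarrow> 'a set" where
  "isolated_vertices H = {x \<in> fst H. \<forall>e \<in> snd H. x \<notin> e}"

(* The hyperedges stay the same: no hyperedge contains an isolated vertex. *)
definition remove_isolated :: "'a hypergraph \<Rightarrow> 'a hypergraph" where
  "remove_isolated H = (fst H - isolated_vertices H, snd H)"

(* The sequence x_1, e_1, ..., e_(k-1), x_k is split into the list xs of its vertices and
   the list es of its hyperedges, both indexed from 0. *)
definition hypergraph_path ::
  "'a hypergraph \<Rightarrow> 'a \<Rightarrow> 'a list \<Rightarrow> 'a set list \<Rightarrow> 'a \<Rightarrow> bool" where
  "hypergraph_path H x xs es y \<longleftrightarrow>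
     length xs = Suc (length es) \<and> hd xs = x \<and> last xs = y \<and>
     distinct xs \<and> set xs \<subseteq> fst H \<and> set es \<subseteq> snd H \<and>
     (\<forall>j < length es. xs ! j \<in> es ! j \<and> xs ! Suc j \<in> es ! j)"

definition hypergraph_connected :: "'a hypergraph \<Rightarrow> bool" where
  "hypergraph_connected H \<longleftrightarrow>
     (\<forall>x \<in> fst H. \<forall>y \<in> fst H. x \<noteq> y \<longrightarrow> (\<exists>xs es. hypergraph_path H x xs es y))"

definition minimal_generating_set :: "('a, 'b) monoid_scheme \<Rightarrow> 'a set \<Rightarrow> bool" where
  "minimal_generating_set G S \<longleftrightarrow>
     S \<subseteq> carrier G \<and> generate G S = carrier G \<and>
     (\<forall>T. T \<subset> S \<longrightarrow> generate G T \<noteq> carrier G)"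

definition generating_hypergraph :: "('a, 'b) monoid_scheme \<Rightarrow> 'a hypergraph" where
  "generating_hypergraph G = (carrier G, {S. minimal_generating_set G S})"

definition maximal_subgroup :: "'a set \<Rightarrow> ('a, 'b) monoid_scheme \<Rightarrow> bool" where
  "maximal_subgroup M G \<longleftrightarrow>
     subgroup M G \<and> M \<noteq> carrier G \<and>
     (\<forall>K. subgroup K G \<longrightarrow> M \<subseteq> K \<longrightarrow> K = M \<or> K = carrier G)"

(* Intersecting with the carrier makes a group without maximal subgroups its own Frattini
   subgroup. *)
definition Frattini_subgroup :: "('a, 'b) monoid_scheme \<Rightarrow> 'a set" where
  "Frattini_subgroup G = carrier G \<inter> \<Inter>{M. maximal_subgroup M G}"

end

theory Submission
  imports Defs
begin

text \<open>Suppose that the non-Frattini elements are the disjoint union of two nonempty sets \<open>A\<close> and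
  \<open>B\<close> such that each minimal generating set lies inside one of them. A maximal subgroup \<open>M\<close> is the
  union of the subgroups generated by \<open>(M \<inter> A) \<union> Frat(G)\<close> and \<open>(M \<inter> B) \<union> Frat(G)\<close>, so it equals one
  of them, say the second. If some \<open>x \<in> A\<close> were outside \<open>M\<close>, then \<open>(M \<inter> B) \<union> Frat(G) \<union> {x}\<close> would
  contain a minimal generating set, which contains \<open>x\<close>, so lies in \<open>A\<close>, so equals \<open>{x}\<close>, although \<open>G\<close>
  is not cyclic. Hence each maximal subgroup contains \<open>A\<close> or \<open>B\<close>. Now \<open>G\<close> is the union of two
  subgroups: the intersection of the maximal subgroups containing \<open>A\<close>, and of those containing \<open>B\<close>.
  So one of them is \<open>G\<close>, which puts \<open>B\<close> or \<open>A\<close> inside \<open>Frat(G)\<close>.\<close>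

text \<open>Vertices on a path are distinct, so \<open>z\<close> is appended only if it is new;
  otherwise the path is cut off at its occurrence of \<open>z\<close>.\<close>

lemma hypergraph_path_extend:
  assumes p: "hypergraph_path H x xs es y"
    and e: "e \<in> snd H" "y \<in> e" "z \<in> e" and z: "z \<in> fst H"
  shows "\<exists>xs' es'. hypergraph_path H x xs' es' z"
proof (cases "z \<in> set xs")
  case True
  then obtain k where k: "k < length xs" "xs ! k = z"
    by (auto simp: in_set_conv_nth)
  have "hypergraph_path H x (take (Suc k) xs) (take k es) z"
    unfolding hypergraph_path_def
  proof (intro conjI)
    show "last (take (Suc k) xs) = z" using k by (simp add: take_Suc_conv_app_nth)
    show "set (take (Suc k) xs) \<subseteq> fst H" "set (take k es) \<subseteq> snd H"
      using p by (auto simp: hypergraph_path_def dest: in_set_takeD)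
  qed (use p k in \<open>auto simp: hypergraph_path_def\<close>)
  then show ?thesis by blast
next
  case False
  \<comment> \<open>The appended hyperedge \<open>e\<close> gets index \<open>length es\<close>, so
    it has to contain the vertex at that index.\<close>
  have y: "xs ! length es = y"
    using p unfolding hypergraph_path_def by (cases xs rule: rev_cases) (auto simp: nth_append)
  have "hypergraph_path H x (xs @ [z]) (es @ [e]) z"
    using p e z False y unfolding hypergraph_path_def
    by (auto simp: nth_append less_Suc_eq hd_append)
  then show ?thesis by blast
qed

text \<open>The vertices reachable from a fixed vertex form a nonempty set closed under sharing a
  hyperedge.\<close>

lemma hypergraph_connectedI:
  assumes "\<And>A. A \<subseteq> fst H \<Longrightarrow> A \<noteq> {} \<Longrightarrow>
      (\<And>e. e \<in> snd H \<Longrightarrow> e \<inter> A \<noteq> {} \<Longrightarrow> e \<inter> fst H \<subseteq> A) \<Longrightarrow> fst H \<subseteq> A"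
  shows "hypergraph_connected H"
  unfolding hypergraph_connected_def
proof (intro ballI impI)
  fix x y assume x: "x \<in> fst H" and y: "y \<in> fst H"
  define A where "A = {z \<in> fst H. \<exists>xs es. hypergraph_path H x xs es z}"
  have "hypergraph_path H x [x] [] x"
    using x by (simp add: hypergraph_path_def)
  then have "x \<in> A" using x by (auto simp: A_def)
  then have "fst H \<subseteq> A"
    by (intro assms) (auto simp: A_def intro: hypergraph_path_extend)
  then show "\<exists>xs es. hypergraph_path H x xs es y"
    using y by (auto simp: A_def)
qed

lemma minimal_generating_subset:
  assumes "finite S" "S \<subseteq> carrier G" "generate G S = carrier G"
  shows "\<exists>T\<subseteq>S. minimal_generating_set G T"
  using assms
proof (induction S rule: finite_psubset_induct)
  case (psubset S)
  show ?case
  proof (cases "minimal_generating_set G S")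
    case False
    then obtain T where T: "T \<subset> S" "generate G T = carrier G"
      using psubset.prems by (auto simp: minimal_generating_set_def)
    then have "\<exists>U\<subseteq>T. minimal_generating_set G U"
      using psubset by blast
    then show ?thesis using T by blast
  qed blast
qed

context group
begin

text \<open>If \<open>x\<close> in \<open>H\<close> avoids \<open>K\<close> and \<open>y\<close> in
  \<open>H\<close> avoids \<open>L\<close>, then \<open>x \<otimes> y\<close> lies in neither
  \<open>K\<close> nor \<open>L\<close>.\<close>

lemma subgroup_subset_Un:
  assumes H: "subgroup H G" and K: "subgroup K G" and L: "subgroup L G" and sub: "H \<subseteq> K \<union> L"
  shows "H \<subseteq> K \<or> H \<subseteq> L"
proof (rule ccontr)
  assume "\<not> (H \<subseteq> K \<or> H \<subseteq> L)"
  then obtain x y where x: "x \<in> H" "x \<notin> K" and y: "y \<in> H" "y \<notin> L" by blast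
  then have xL: "x \<in> L" and yK: "y \<in> K" using sub by auto
  have c: "x \<in> carrier G" "y \<in> carrier G"
    using x y H subgroup.mem_carrier by fast+
  have "x \<otimes> y \<in> K \<union> L" using sub subgroup.m_closed[OF H x(1) y(1)] by blast
  then show False
  proof
    assume "x \<otimes> y \<in> K"
    then have "(x \<otimes> y) \<otimes> inv y \<in> K"
      using K yK by (simp add: subgroup.m_closed subgroup.m_inv_closed)
    then show False using x c by (simp add: m_assoc)
  next
    assume "x \<otimes> y \<in> L"
    then have "inv x \<otimes> (x \<otimes> y) \<in> L"
      using L xL by (simp add: subgroup.m_closed subgroup.m_inv_closed)
    then show False using y c by (simp flip: m_assoc)
  qed
qed

lemma maximal_subgroup_exists:
  assumes "finite (carrier G)" "subgroup H G" "H \<noteq> carrier G"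
  shows "\<exists>M. maximal_subgroup M G \<and> H \<subseteq> M"
proof -
  let ?P = "{K. subgroup K G \<and> K \<noteq> carrier G}"
  have "?P \<subseteq> Pow (carrier G)" using subgroup.subset by blast
  then have "finite ?P" using assms(1) by (simp add: finite_subset)
  from finite_has_maximal2[OF this, of H] assms obtain M
    where "M \<in> ?P" "H \<subseteq> M" "\<forall>K\<in>?P. M \<subseteq> K \<longrightarrow> M = K" by auto
  then show ?thesis unfolding maximal_subgroup_def by blast
qed

lemma generate_maximal_insert:
  assumes "maximal_subgroup M G" "x \<in> carrier G" "x \<notin> M"
  shows "generate G (insert x M) = carrier G"
proof -
  have M: "subgroup M G" using assms by (simp add: maximal_subgroup_def)
  then have "insert x M \<subseteq> carrier G" using assms subgroup.subset by blast
  then have "subgroup (generate G (insert x M)) G" by (rule generate_is_subgroup)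
  moreover have "insert x M \<subseteq> generate G (insert x M)" by (auto intro: generate.incl)
  ultimately show ?thesis using assms unfolding maximal_subgroup_def by blast
qed

text \<open>By maximality \<open>insert x S\<close> generates the group, and a generating subset
  without \<open>x\<close> would stay inside \<open>M\<close>. The freedom to choose
  \<open>S\<close> smaller than \<open>M\<close> controls what the hyperedge through
  \<open>x\<close> can contain.\<close>

lemma minimal_generating_set_insert:
  assumes fin: "finite (carrier G)" and M: "maximal_subgroup M G"
    and S: "S \<subseteq> carrier G" "generate G S = M" and x: "x \<in> carrier G" "x \<notin> M"
  shows "\<exists>T. minimal_generating_set G T \<and> x \<in> T \<and> T \<subseteq> insert x S"
proof -
  have sub: "insert x S \<subseteq> carrier G" using S x by blast
  have K: "subgroup (generate G (insert x S)) G" by (rule generate_is_subgroup[OF sub])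
  have "M \<subseteq> generate G (insert x S)"
    using mono_generate[of S "insert x S"] S by blast
  then have "generate G (insert x M) \<subseteq> generate G (insert x S)"
    by (intro generate_subgroup_incl K) (auto intro: generate.incl)
  then have "generate G (insert x S) = carrier G"
    using generate_maximal_insert[OF M x] generate_incl[OF sub] by blast
  then obtain T where T: "T \<subseteq> insert x S" "minimal_generating_set G T"
    using minimal_generating_subset[OF finite_subset[OF sub fin] sub] by blast
  have "x \<in> T"
  proof (rule ccontr)
    assume "x \<notin> T"
    then have "generate G T \<subseteq> M" using T mono_generate[of T S] S by blast
    then show False using T x by (auto simp: minimal_generating_set_def)
  qed
  then show ?thesis using T by blast
qed

lemma isolated_generating_hypergraph:
  assumes fin: "finite (carrier G)"
  shows "isolated_vertices (generating_hypergraph G) = Frattini_subgroup G"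
proof -
  have "(\<exists>S. minimal_generating_set G S \<and> x \<in> S) \<longleftrightarrow> (\<exists>M. maximal_subgroup M G \<and> x \<notin> M)"
    if x: "x \<in> carrier G" for x
  proof
    assume "\<exists>S. minimal_generating_set G S \<and> x \<in> S"
    then obtain S where S: "minimal_generating_set G S" "x \<in> S" by blast
    \<comment> \<open>Minimality of \<open>S\<close> makes \<open>?H\<close> proper. A maximal
      subgroup above it omits \<open>x\<close>, since otherwise it would contain all of
      \<open>S\<close>.\<close>
    let ?H = "generate G (S - {x})"
    have sub: "S - {x} \<subseteq> carrier G" and ne: "?H \<noteq> carrier G"
      using S by (auto simp: minimal_generating_set_def)
    obtain M where M: "maximal_subgroup M G" "?H \<subseteq> M"
      using maximal_subgroup_exists[OF fin generate_is_subgroup[OF sub] ne] by blast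
    have "x \<notin> M"
    proof
      assume "x \<in> M"
      then have "S \<subseteq> M" using M(2) by (auto intro: generate.incl)
      then have "carrier G \<subseteq> M"
        using generate_subgroup_incl[of S M] S M
        by (simp add: minimal_generating_set_def maximal_subgroup_def)
      then show False
        using M(1) subgroup.subset unfolding maximal_subgroup_def by blast
    qed
    with M show "\<exists>M. maximal_subgroup M G \<and> x \<notin> M" by blast
  next
    assume "\<exists>M. maximal_subgroup M G \<and> x \<notin> M"
    then obtain M where M: "maximal_subgroup M G" "x \<notin> M" by blast
    then have sg: "subgroup M G" by (simp add: maximal_subgroup_def)
    have "generate G M = M"
      using generate_subgroup_incl[OF subset_refl sg] by (auto intro: generate.incl)
    then show "\<exists>S. minimal_generating_set G S \<and> x \<in> S"
      using minimal_generating_set_insert[OF fin M(1) subgroup.subset[OF sg] _ x M(2)] by blast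
  qed
  then show ?thesis
    by (auto simp: isolated_vertices_def generating_hypergraph_def Frattini_subgroup_def)
qed

text \<open>The factor \<open>carrier G\<close> covers the empty family, whose intersection is the
  whole type.\<close>

lemma subgroup_carrier_Int_Inter:
  assumes "\<And>H. H \<in> \<H> \<Longrightarrow> subgroup H G"
  shows "subgroup (carrier G \<inter> \<Inter>\<H>) G"
  using assms by unfold_locales (auto simp: subgroup.m_closed subgroup.one_closed subgroup.m_inv_closed)

lemma generating_hypergraph_connected:
  assumes fin: "finite (carrier G)" and ncyc: "\<not> cyclic_group G"
  shows "hypergraph_connected (remove_isolated (generating_hypergraph G))"
proof (rule hypergraph_connectedI)
  let ?H = "remove_isolated (generating_hypergraph G)"
  let ?F = "Frattini_subgroup G"
  fix A
  assume A: "A \<subseteq> fst ?H" "A \<noteq> {}"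
    and closed: "\<And>e. e \<in> snd ?H \<Longrightarrow> e \<inter> A \<noteq> {} \<Longrightarrow> e \<inter> fst ?H \<subseteq> A"
  have V: "fst ?H = carrier G - ?F"
    using isolated_generating_hypergraph[OF fin]
    by (simp add: remove_isolated_def generating_hypergraph_def)
  have edge_V: "S \<subseteq> fst ?H" if "minimal_generating_set G S" for S
    using that by (auto simp: remove_isolated_def generating_hypergraph_def
        isolated_vertices_def minimal_generating_set_def)
  have edge: "S \<subseteq> A" if "minimal_generating_set G S" "S \<inter> A \<noteq> {}" for S
    using closed[of S] that edge_V[of S]
    by (auto simp: remove_isolated_def generating_hypergraph_def)
  have not_singleton: "\<not> minimal_generating_set G {x}" for x
  proof
    assume "minimal_generating_set G {x}"
    then have x: "x \<in> carrier G" and "generate G {x} = carrier G"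
      by (simp_all add: minimal_generating_set_def)
    then have "carrier G = range (\<lambda>n::int. x [^] n)"
      using generate_pow[OF x] by (simp add: full_SetCompr_eq)
    then show False using ncyc x unfolding cyclic_group by blast
  qed
  have F_sub: "?F \<subseteq> M" if "maximal_subgroup M G" for M
    using that by (auto simp: Frattini_subgroup_def)
  have max_sg: "subgroup M G" if "maximal_subgroup M G" for M
    using that by (simp add: maximal_subgroup_def)
  \<comment> \<open>\<open>B\<close> may be empty: the argument is direct and ends by placing
    \<open>B\<close> inside \<open>?F\<close>, from which it is disjoint.\<close>
  define B where "B = fst ?H - A"
  have absorb: "X \<subseteq> M"
    if M: "maximal_subgroup M G" and gen: "generate G (M \<inter> Y \<union> ?F) = M"
      and XY: "X = A \<and> Y = B \<or> X = B \<and> Y = A" for M X Y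
  proof (rule ccontr)
    assume "\<not> X \<subseteq> M"
    then obtain x where x: "x \<in> X" "x \<notin> M" by blast
    have "x \<in> carrier G" using x XY A V by (auto simp: B_def)
    moreover have "M \<inter> Y \<union> ?F \<subseteq> carrier G"
      using M F_sub[OF M] subgroup.subset[OF max_sg[OF M]] by blast
    ultimately obtain T where T: "minimal_generating_set G T" "x \<in> T" "T \<subseteq> insert x (M \<inter> Y \<union> ?F)"
      using minimal_generating_set_insert[OF fin M _ gen] x by blast
    \<comment> \<open>For \<open>X = B\<close>: if \<open>T\<close> met \<open>A\<close>, then
      \<open>edge\<close> would put \<open>x\<close> into \<open>A\<close>.\<close>
    have "T \<subseteq> X" using edge[OF T(1)] edge_V[OF T(1)] T(2) x XY unfolding B_def by blast
    moreover have "X \<inter> Y = {}" using XY by (auto simp: B_def)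
    \<comment> \<open>Apart from \<open>x\<close>, elements of \<open>T\<close> could come only from
      \<open>Y\<close> or \<open>?F\<close>; \<open>T\<close> avoids both, as hyperedges have no
      isolated vertices.\<close>
    ultimately have "T = {x}" using T edge_V[OF T(1)] V by blast
    then show False using T not_singleton by blast
  qed
  have dichotomy: "A \<subseteq> M \<or> B \<subseteq> M" if M: "maximal_subgroup M G" for M
  proof -
    have sg: "subgroup M G" by (rule max_sg[OF M])
    have mem: "M \<inter> Y \<union> ?F \<subseteq> M" for Y using F_sub[OF M] by blast
    then have car: "M \<inter> Y \<union> ?F \<subseteq> carrier G" for Y using subgroup.subset[OF sg] by blast
    have le: "generate G (M \<inter> Y \<union> ?F) \<subseteq> M" for Y
      by (rule generate_subgroup_incl[OF mem sg])
    have "M \<subseteq> (M \<inter> A \<union> ?F) \<union> (M \<inter> B \<union> ?F)"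
      using V subgroup.subset[OF sg] by (auto simp: B_def)
    then have "M \<subseteq> generate G (M \<inter> A \<union> ?F) \<union> generate G (M \<inter> B \<union> ?F)"
      using generate.incl[of _ "M \<inter> A \<union> ?F" G] generate.incl[of _ "M \<inter> B \<union> ?F" G] by blast
    from subgroup_subset_Un[OF sg generate_is_subgroup[OF car] generate_is_subgroup[OF car] this]
    show ?thesis using le absorb[OF M] by blast
  qed
  \<comment> \<open>If no maximal subgroup contains \<open>X\<close>, then \<open>N X\<close> is
    \<open>carrier G\<close>; \<open>none\<close> below is the converse.\<close>
  define N where "N X = carrier G \<inter> \<Inter>{M. maximal_subgroup M G \<and> X \<subseteq> M}" for X
  have N_sg: "subgroup (N X) G" for X
    unfolding N_def by (rule subgroup_carrier_Int_Inter) (simp add: max_sg)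
  have "carrier G \<subseteq> N A \<union> N B"
  proof
    fix x assume x: "x \<in> carrier G"
    then consider "x \<in> ?F" | "x \<in> A" | "x \<in> B" using V by (auto simp: B_def)
    then show "x \<in> N A \<union> N B"
      using x F_sub by cases (auto simp: N_def)
  qed
  then have full: "carrier G \<subseteq> N A \<or> carrier G \<subseteq> N B"
    by (rule subgroup_subset_Un[OF subgroup_self N_sg N_sg])
  have none: "\<not> X \<subseteq> M" if "carrier G \<subseteq> N X" "maximal_subgroup M G" for X M
    using that subgroup.subset[OF max_sg[OF that(2)]]
    unfolding N_def maximal_subgroup_def by blast
  \<comment> \<open>Otherwise no maximal subgroup contains \<open>B\<close>, so by
    \<open>dichotomy\<close> all contain \<open>A\<close>, and the nonempty set \<open>A\<close>
    would lie in \<open>?F\<close>.\<close>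
  have "\<not> carrier G \<subseteq> N B"
  proof
    assume "carrier G \<subseteq> N B"
    then have "A \<subseteq> ?F"
      using none dichotomy A(1) V unfolding Frattini_subgroup_def by blast
    then show False using A V by blast
  qed
  then have "carrier G \<subseteq> N A" using full by blast
  then have "B \<subseteq> ?F"
    using none dichotomy V unfolding Frattini_subgroup_def B_def by blast
  then show "fst ?H \<subseteq> A" using V by (auto simp: B_def)
qed

end

theorem theorem1:
  fixes G :: "('a, 'b) monoid_scheme"
  assumes "group G" and "finite (carrier G)" and "\<not> cyclic_group G"
  shows "isolated_vertices (generating_hypergraph G) = Frattini_subgroup G \<and>
         hypergraph_connected (remove_isolated (generating_hypergraph G))"
  using assms group.isolated_generating_hypergraph group.generating_hypergraph_connected by blast

end
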